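(* Let $\mathcal A=\mathcal B\ltimes_\eta\mathsf F$ be an $\eta$-extension and let $d\ge 1$. The following conditions are equivalent: (1) $\mathcal A$ is uniformly image-nilpotent of index at most $d$; (2) $\eta^{[d]}:\mathsf F^d\to\mathsf F$ is the zero natural transformation. In particular, every right trivial extension (that is, every $\eta$-extension with $\eta=0$) is uniformly image-nilpotent of index at most two.
   Context: Conventions: abelian categories under consideration have enough projective and enough injective objects. Let $\mathcal B$ be an abelian category, $\mathsf F:\mathcal B\to\mathcal B$ a covariant right exact additive functor, and $\eta:\mathsf F^2\to\mathsf F$ a natural transformation that is associative, i.e. $\eta\circ\mathsf F\eta=\eta\circ\eta\mathsf F$. The $\eta$-extension $\mathcal A=\mathcal B\ltimes_\eta\mathsf F$ is the category whose objects are pairs $(B,f)$ with $B\in\mathcal B$ and $f:\mathsf F(B)\to B$ satisfying $f\,\mathsf F(f)=f\,\eta_B$, and whose morphisms $(B,f)\to(B',f')$ are morphisms $\alpha:B\to B'$ in $\mathcal B$ with $\alpha f=f'\mathsf F(\alpha)$. It is abelian, and a sequence in $\mathcal A$ is exact iff the underlying sequence in $\mathcal B$ is exact. Iterated multiplication: $\eta^{[1]}=1_{\mathsf F}$ and $\eta^{[r+1]}=\eta\circ\mathsf F(\eta^{[r]}):\mathsf F^{r+1}\to\mathsf F$ for $r\ge1$. Image functor: for $A=(B,f)\in\mathcal A$ with image factorization $f=i_Aq_A$, $q_A:\mathsf F(B)\twoheadrightarrow\operatorname{Im}f$, $i_A:\operatorname{Im}f\rightarrowtail B$, put $\mathsf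 I(A)=(\operatorname{Im}f,\,q_A\mathsf F(i_A))$, which is an object of $\mathcal A$ and a subobject of $A$ via $i_A$. Set $\mathsf I^0(A)=A$ and $\mathsf I^{r+1}(A)=\mathsf I(\mathsf I^r(A))$. The extension $\mathcal A$ is uniformly image-nilpotent of index at most $d$ if $\mathsf I^d(A)=0$ for every $A\in\mathcal A$. *)

theory Defs
  imports "HOL-Algebra.Group"
begin

section \<open>Abelian categories\<close>

record ('o, 'm) cat =
  Obj :: "'o set"
  Arr :: "'m set"
  Dom :: "'m \<Rightarrow> 'o"
  Cod :: "'m \<Rightarrow> 'o"
  Ident :: "'o \<Rightarrow> 'm"
  Comp :: "'m \<Rightarrow> 'm \<Rightarrow> 'm" (infixl \<open>\<cdot>\<index>\<close> 70)

definition Hom :: "('o, 'm, 'z) cat_scheme \<Rightarrow> 'o \<Rightarrow> 'o \<Rightarrow> 'm set" where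
  "Hom C a b = {f \<in> Arr C. Dom C f = a \<and> Cod C f = b}"

text \<open>
  Composition is written in the order of functions: \<open>g \<cdot>\<^bsub>C\<^esub> f\<close> is \<open>g\<close> after \<open>f\<close>, and it is
  meaningful only if \<open>f\<close> and \<open>g\<close> are arrows with \<open>Cod C f = Dom C g\<close>.
\<close>

locale category =
  fixes C :: "('o, 'm, 'z) cat_scheme" (structure)
  assumes Dom_Obj: "f \<in> Arr C \<Longrightarrow> Dom C f \<in> Obj C"
    and Cod_Obj: "f \<in> Arr C \<Longrightarrow> Cod C f \<in> Obj C"
    and Ident_Hom: "a \<in> Obj C \<Longrightarrow> Ident C a \<in> Hom C a a"
    and Comp_Hom: "\<lbrakk>f \<in> Hom C a b; g \<in> Hom C b c\<rbrakk> \<Longrightarrow> g \<cdot> f \<in> Hom C a c"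
    and Comp_assoc: "\<lbrakk>f \<in> Hom C a b; g \<in> Hom C b c; h \<in> Hom C c d\<rbrakk>
        \<Longrightarrow> h \<cdot> (g \<cdot> f) = (h \<cdot> g) \<cdot> f"
    and Comp_Ident: "f \<in> Hom C a b \<Longrightarrow> f \<cdot> Ident C a = f"
    and Ident_Comp: "f \<in> Hom C a b \<Longrightarrow> Ident C b \<cdot> f = f"

definition monic :: "('o, 'm, 'z) cat_scheme \<Rightarrow> 'm \<Rightarrow> bool" where
  "monic C f \<longleftrightarrow> f \<in> Arr C \<and>
     (\<forall>x. \<forall>g \<in> Hom C x (Dom C f). \<forall>h \<in> Hom C x (Dom C f). f \<cdot>\<^bsub>C\<^esub> g = f \<cdot>\<^bsub>C\<^esub> h \<longrightarrow> g = h)"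

definition epic :: "('o, 'm, 'z) cat_scheme \<Rightarrow> 'm \<Rightarrow> bool" where
  "epic C f \<longleftrightarrow> f \<in> Arr C \<and>
     (\<forall>y. \<forall>g \<in> Hom C (Cod C f) y. \<forall>h \<in> Hom C (Cod C f) y. g \<cdot>\<^bsub>C\<^esub> f = h \<cdot>\<^bsub>C\<^esub> f \<longrightarrow> g = h)"

definition zero_object :: "('o, 'm, 'z) cat_scheme \<Rightarrow> 'o \<Rightarrow> bool" where
  "zero_object C z \<longleftrightarrow> z \<in> Obj C \<and>
     (\<forall>a \<in> Obj C. (\<exists>!f. f \<in> Hom C z a) \<and> (\<exists>!f. f \<in> Hom C a z))"

definition projective :: "('o, 'm, 'z) cat_scheme \<Rightarrow> 'o \<Rightarrow> bool" where
  "projective C p \<longleftrightarrow> p \<in> Obj C \<and>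
     (\<forall>e g. epic C e \<and> g \<in> Hom C p (Cod C e) \<longrightarrow> (\<exists>h \<in> Hom C p (Dom C e). e \<cdot>\<^bsub>C\<^esub> h = g))"

definition injective :: "('o, 'm, 'z) cat_scheme \<Rightarrow> 'o \<Rightarrow> bool" where
  "injective C q \<longleftrightarrow> q \<in> Obj C \<and>
     (\<forall>m g. monic C m \<and> g \<in> Hom C (Dom C m) q \<longrightarrow> (\<exists>h \<in> Hom C (Cod C m) q. h \<cdot>\<^bsub>C\<^esub> m = g))"

definition enough_projectives :: "('o, 'm, 'z) cat_scheme \<Rightarrow> bool" where
  "enough_projectives C \<longleftrightarrow>
     (\<forall>a \<in> Obj C. \<exists>p. projective C p \<and> (\<exists>e \<in> Hom C p a. epic C e))"

definition enough_injectives :: "('o, 'm, 'z) cat_scheme \<Rightarrow> bool" where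
  "enough_injectives C \<longleftrightarrow>
     (\<forall>a \<in> Obj C. \<exists>q. injective C q \<and> (\<exists>m \<in> Hom C a q. monic C m))"

record ('o, 'm) addcat = "('o, 'm) cat" +
  Add :: "'m \<Rightarrow> 'm \<Rightarrow> 'm"
  Zero :: "'o \<Rightarrow> 'o \<Rightarrow> 'm"

definition hom_group :: "('o, 'm, 'z) addcat_scheme \<Rightarrow> 'o \<Rightarrow> 'o \<Rightarrow> 'm monoid" where
  "hom_group C a b = \<lparr>carrier = Hom C a b, mult = Add C, one = Zero C a b\<rparr>"

locale preadditive_category = category C
  for C :: "('o, 'm, 'z) addcat_scheme" (structure) +
  assumes hom_group: "\<lbrakk>a \<in> Obj C; b \<in> Obj C\<rbrakk> \<Longrightarrow> comm_group (hom_group C a b)"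
    and Comp_Add: "\<lbrakk>f \<in> Hom C a b; f' \<in> Hom C a b; g \<in> Hom C b c\<rbrakk>
        \<Longrightarrow> g \<cdot> Add C f f' = Add C (g \<cdot> f) (g \<cdot> f')"
    and Add_Comp: "\<lbrakk>f \<in> Hom C a b; g \<in> Hom C b c; g' \<in> Hom C b c\<rbrakk>
        \<Longrightarrow> Add C g g' \<cdot> f = Add C (g \<cdot> f) (g' \<cdot> f)"

definition is_kernel :: "('o, 'm, 'z) addcat_scheme \<Rightarrow> 'm \<Rightarrow> 'm \<Rightarrow> bool" where
  "is_kernel C k f \<longleftrightarrow> f \<in> Arr C \<and> k \<in> Arr C \<and> Cod C k = Dom C f \<and>
     f \<cdot>\<^bsub>C\<^esub> k = Zero C (Dom C k) (Cod C f) \<and>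
     (\<forall>x. \<forall>t \<in> Hom C x (Dom C f). f \<cdot>\<^bsub>C\<^esub> t = Zero C x (Cod C f) \<longrightarrow>
        (\<exists>!u. u \<in> Hom C x (Dom C k) \<and> k \<cdot>\<^bsub>C\<^esub> u = t))"

definition is_cokernel :: "('o, 'm, 'z) addcat_scheme \<Rightarrow> 'm \<Rightarrow> 'm \<Rightarrow> bool" where
  "is_cokernel C c f \<longleftrightarrow> f \<in> Arr C \<and> c \<in> Arr C \<and> Dom C c = Cod C f \<and>
     c \<cdot>\<^bsub>C\<^esub> f = Zero C (Dom C f) (Cod C c) \<and>
     (\<forall>y. \<forall>t \<in> Hom C (Cod C f) y. t \<cdot>\<^bsub>C\<^esub> f = Zero C (Dom C f) y \<longrightarrow>
        (\<exists>!u. u \<in> Hom C (Cod C c) y \<and> u \<cdot>\<^bsub>C\<^esub> c = t))"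

definition is_biproduct ::
  "('o, 'm, 'z) addcat_scheme \<Rightarrow> 'o \<Rightarrow> 'o \<Rightarrow> 'o \<Rightarrow> 'm \<Rightarrow> 'm \<Rightarrow> 'm \<Rightarrow> 'm \<Rightarrow> bool" where
  "is_biproduct C a b s i j p q \<longleftrightarrow>
     i \<in> Hom C a s \<and> j \<in> Hom C b s \<and> p \<in> Hom C s a \<and> q \<in> Hom C s b \<and>
     p \<cdot>\<^bsub>C\<^esub> i = Ident C a \<and> q \<cdot>\<^bsub>C\<^esub> j = Ident C b \<and>
     p \<cdot>\<^bsub>C\<^esub> j = Zero C b a \<and> q \<cdot>\<^bsub>C\<^esub> i = Zero C a b \<and>
     Add C (i \<cdot>\<^bsub>C\<^esub> p) (j \<cdot>\<^bsub>C\<^esub> q) = Ident C s"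

locale abelian_category = preadditive_category C
  for C :: "('o, 'm, 'z) addcat_scheme" (structure) +
  assumes zero_object: "\<exists>z. zero_object C z"
    and biproducts: "\<lbrakk>a \<in> Obj C; b \<in> Obj C\<rbrakk> \<Longrightarrow> \<exists>s i j p q. is_biproduct C a b s i j p q"
    and kernels: "f \<in> Arr C \<Longrightarrow> \<exists>k. is_kernel C k f"
    and cokernels: "f \<in> Arr C \<Longrightarrow> \<exists>c. is_cokernel C c f"
    and monic_kernel: "monic C m \<Longrightarrow> \<exists>f. is_kernel C m f"
    and epic_cokernel: "epic C e \<Longrightarrow> \<exists>f. is_cokernel C e f"

text \<open>\<open>f = i q\<close> with \<open>q\<close> an epimorphism onto \<open>e\<close> and \<open>i\<close> a monomorphism.\<close>

definition image_factorization ::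
  "('o, 'm, 'z) cat_scheme \<Rightarrow> 'm \<Rightarrow> 'o \<Rightarrow> 'm \<Rightarrow> 'm \<Rightarrow> bool" where
  "image_factorization C f e q i \<longleftrightarrow>
     q \<in> Hom C (Dom C f) e \<and> epic C q \<and> i \<in> Hom C e (Cod C f) \<and> monic C i \<and> f = i \<cdot>\<^bsub>C\<^esub> q"

text \<open>Exactness of \<open>f\<close> followed by \<open>g\<close> at the middle object: the image of \<open>f\<close> is a kernel of \<open>g\<close>.\<close>

definition exact_pair :: "('o, 'm, 'z) addcat_scheme \<Rightarrow> 'm \<Rightarrow> 'm \<Rightarrow> bool" where
  "exact_pair C f g \<longleftrightarrow> f \<in> Arr C \<and> g \<in> Arr C \<and> Cod C f = Dom C g \<and>
     (\<exists>e q i. image_factorization C f e q i \<and> is_kernel C i g)"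

text \<open>Exactness of \<open>a \<rightarrow> b \<rightarrow> c \<rightarrow> 0\<close> with arrows \<open>f\<close> and \<open>g\<close>.\<close>

definition right_exact_sequence :: "('o, 'm, 'z) addcat_scheme \<Rightarrow> 'm \<Rightarrow> 'm \<Rightarrow> bool" where
  "right_exact_sequence C f g \<longleftrightarrow> exact_pair C f g \<and> epic C g"


section \<open>Functors and natural transformations\<close>

record ('o, 'm, 'p, 'n) func =
  OMap :: "'o \<Rightarrow> 'p"
  AMap :: "'m \<Rightarrow> 'n"

locale covariant_functor = source: category C + target: category D
  for C :: "('o, 'm, 'y) cat_scheme" and D :: "('p, 'n, 'z) cat_scheme"
    and F :: "('o, 'm, 'p, 'n) func" +
  assumes AMap_Hom: "f \<in> Hom C a b \<Longrightarrow> AMap F f \<in> Hom D (OMap F a) (OMap F b)"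
    and OMap_Obj: "a \<in> Obj C \<Longrightarrow> OMap F a \<in> Obj D"
    and AMap_Ident: "a \<in> Obj C \<Longrightarrow> AMap F (Ident C a) = Ident D (OMap F a)"
    and AMap_Comp: "\<lbrakk>f \<in> Hom C a b; g \<in> Hom C b c\<rbrakk>
        \<Longrightarrow> AMap F (g \<cdot>\<^bsub>C\<^esub> f) = AMap F g \<cdot>\<^bsub>D\<^esub> AMap F f"

locale additive_functor = covariant_functor C D F +
    source: preadditive_category C + target: preadditive_category D
  for C :: "('o, 'm, 'y) addcat_scheme" and D :: "('p, 'n, 'z) addcat_scheme"
    and F :: "('o, 'm, 'p, 'n) func" +
  assumes AMap_Add: "\<lbrakk>f \<in> Hom C a b; g \<in> Hom C a b\<rbrakk>
        \<Longrightarrow> AMap F (Add C f g) = Add D (AMap F f) (AMap F g)"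

definition preserves_right_exact_sequences ::
  "('o, 'm, 'y) addcat_scheme \<Rightarrow> ('p, 'n, 'z) addcat_scheme \<Rightarrow> ('o, 'm, 'p, 'n) func \<Rightarrow> bool" where
  "preserves_right_exact_sequences C D F \<longleftrightarrow>
     (\<forall>f g. right_exact_sequence C f g \<longrightarrow> right_exact_sequence D (AMap F f) (AMap F g))"

definition functor_id :: "('o, 'm, 'o, 'm) func" where
  "functor_id = \<lparr>OMap = id, AMap = id\<rparr>"

definition functor_comp ::
  "('p, 'n, 'q, 'k) func \<Rightarrow> ('o, 'm, 'p, 'n) func \<Rightarrow> ('o, 'm, 'q, 'k) func" where
  "functor_comp G F = \<lparr>OMap = OMap G \<circ> OMap F, AMap = AMap G \<circ> AMap F\<rparr>"

primrec functor_power :: "('o, 'm, 'o, 'm) func \<Rightarrow> nat \<Rightarrow> ('o, 'm, 'o, 'm) func" where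
  "functor_power F 0 = functor_id"
| "functor_power F (Suc r) = functor_comp F (functor_power F r)"

text \<open>
  A natural transformation is the family of its components. Only the components at objects of the
  source category are meaningful, so equations between natural transformations are required there.
\<close>

locale natural_transformation = source: covariant_functor C D G + target: covariant_functor C D H
  for C :: "('o, 'm, 'y) cat_scheme" and D :: "('p, 'n, 'z) cat_scheme"
    and G H :: "('o, 'm, 'p, 'n) func" and \<tau> :: "'o \<Rightarrow> 'n" +
  assumes component_Hom: "a \<in> Obj C \<Longrightarrow> \<tau> a \<in> Hom D (OMap G a) (OMap H a)"
    and naturality: "f \<in> Hom C a b \<Longrightarrow> \<tau> b \<cdot>\<^bsub>D\<^esub> AMap G f = AMap H f \<cdot>\<^bsub>D\<^esub> \<tau> a"

definition id_transformation ::
  "('p, 'n, 'z) cat_scheme \<Rightarrow> ('o, 'm, 'p, 'n) func \<Rightarrow> 'o \<Rightarrow> 'n" where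
  "id_transformation D F = (\<lambda>b. Ident D (OMap F b))"

definition vertical_comp ::
  "('p, 'n, 'z) cat_scheme \<Rightarrow> ('o \<Rightarrow> 'n) \<Rightarrow> ('o \<Rightarrow> 'n) \<Rightarrow> 'o \<Rightarrow> 'n" where
  "vertical_comp D \<sigma> \<tau> = (\<lambda>b. \<sigma> b \<cdot>\<^bsub>D\<^esub> \<tau> b)"

text \<open>The whiskerings \<open>F \<tau>\<close> and \<open>\<tau> F\<close>.\<close>

definition whisker_left :: "('p, 'n, 'q, 'k) func \<Rightarrow> ('o \<Rightarrow> 'n) \<Rightarrow> 'o \<Rightarrow> 'k" where
  "whisker_left F \<tau> = (\<lambda>b. AMap F (\<tau> b))"

definition whisker_right :: "('p \<Rightarrow> 'n) \<Rightarrow> ('o, 'm, 'p, 'k) func \<Rightarrow> 'o \<Rightarrow> 'n" where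
  "whisker_right \<tau> F = (\<lambda>b. \<tau> (OMap F b))"

definition is_zero_transformation ::
  "('o, 'm, 'y) cat_scheme \<Rightarrow> ('p, 'n, 'z) addcat_scheme \<Rightarrow>
   ('o, 'm, 'p, 'n) func \<Rightarrow> ('o, 'm, 'p, 'n) func \<Rightarrow> ('o \<Rightarrow> 'n) \<Rightarrow> bool" where
  "is_zero_transformation C D G H \<tau> \<longleftrightarrow>
     (\<forall>b \<in> Obj C. \<tau> b = Zero D (OMap G b) (OMap H b))"


section \<open>Extensions by an associative multiplication\<close>

definition associative_multiplication ::
  "('o, 'm, 'z) cat_scheme \<Rightarrow> ('o, 'm, 'o, 'm) func \<Rightarrow> ('o \<Rightarrow> 'm) \<Rightarrow> bool" where
  "associative_multiplication C F \<eta> \<longleftrightarrow>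
     (\<forall>b \<in> Obj C. vertical_comp C \<eta> (whisker_left F \<eta>) b = vertical_comp C \<eta> (whisker_right \<eta> F) b)"

text \<open>The power with exponent \<open>0\<close> does not occur in the theory and is left unspecified.\<close>

fun mult_power ::
  "('o, 'm, 'z) cat_scheme \<Rightarrow> ('o, 'm, 'o, 'm) func \<Rightarrow> ('o \<Rightarrow> 'm) \<Rightarrow> nat \<Rightarrow> 'o \<Rightarrow> 'm" where
  "mult_power C F \<eta> (Suc 0) = id_transformation C F"
| "mult_power C F \<eta> (Suc (Suc r)) =
     vertical_comp C \<eta> (whisker_left F (mult_power C F \<eta> (Suc r)))"

definition eta_objects ::
  "('o, 'm, 'z) cat_scheme \<Rightarrow> ('o, 'm, 'o, 'm) func \<Rightarrow> ('o \<Rightarrow> 'm) \<Rightarrow> ('o \<times> 'm) set" where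
  "eta_objects C F \<eta> =
     {(b, f). b \<in> Obj C \<and> f \<in> Hom C (OMap F b) b \<and> f \<cdot>\<^bsub>C\<^esub> AMap F f = f \<cdot>\<^bsub>C\<^esub> \<eta> b}"

text \<open>
  The same arrow of the base category may be a morphism between several pairs of objects of the
  extension, so an arrow of the extension is a triple consisting of its domain, the underlying
  arrow, and its codomain.
\<close>

definition eta_extension ::
  "('o, 'm, 'z) addcat_scheme \<Rightarrow> ('o, 'm, 'o, 'm) func \<Rightarrow> ('o \<Rightarrow> 'm) \<Rightarrow>
   ('o \<times> 'm, ('o \<times> 'm) \<times> 'm \<times> ('o \<times> 'm)) addcat" where
  "eta_extension C F \<eta> =
     \<lparr>Obj = eta_objects C F \<eta>,
      Arr = {((b, f), \<alpha>, (b', f')). (b, f) \<in> eta_objects C F \<eta> \<and> (b', f') \<in> eta_objects C F \<eta> \<and>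
               \<alpha> \<in> Hom C b b' \<and> \<alpha> \<cdot>\<^bsub>C\<^esub> f = f' \<cdot>\<^bsub>C\<^esub> AMap F \<alpha>},
      Dom = (\<lambda>(A, \<alpha>, A'). A),
      Cod = (\<lambda>(A, \<alpha>, A'). A'),
      Ident = (\<lambda>A. (A, Ident C (fst A), A)),
      Comp = (\<lambda>(_, \<beta>, A'') (A, \<alpha>, _). (A, \<beta> \<cdot>\<^bsub>C\<^esub> \<alpha>, A'')),
      Add = (\<lambda>(A, \<alpha>, A') (_, \<beta>, _). (A, Add C \<alpha> \<beta>, A')),
      Zero = (\<lambda>A A'. (A, Zero C (fst A) (fst A'), A'))\<rparr>"

text \<open>
  The image functor on objects. Image factorizations are unique only up to isomorphism; one of
  them is chosen.
\<close>

definition image_object ::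
  "('o, 'm, 'z) cat_scheme \<Rightarrow> ('o, 'm, 'o, 'm) func \<Rightarrow> 'o \<times> 'm \<Rightarrow> 'o \<times> 'm" where
  "image_object C F A =
     (let (e, q, i) = (SOME (e, q, i). image_factorization C (snd A) e q i)
      in (e, q \<cdot>\<^bsub>C\<^esub> AMap F i))"

definition uniformly_image_nilpotent ::
  "('o, 'm, 'z) addcat_scheme \<Rightarrow> ('o, 'm, 'o, 'm) func \<Rightarrow> ('o \<Rightarrow> 'm) \<Rightarrow> nat \<Rightarrow> bool" where
  "uniformly_image_nilpotent C F \<eta> d \<longleftrightarrow>
     (\<forall>A \<in> Obj (eta_extension C F \<eta>). zero_object (eta_extension C F \<eta>) ((image_object C F ^^ d) A))"

end

theory Submission
  imports Defs
begin

text \<open>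
  For an object \<open>A = (B, f)\<close> put \<open>f\<^bsup>[0]\<^esup> = 1\<close> and \<open>f\<^bsup>[r+1]\<^esup> = f F(f\<^bsup>[r]\<^esup>)\<close>, an arrow from \<open>F\<^sup>r(B)\<close> to \<open>B\<close>. Since
  \<open>F\<close> preserves epimorphisms, the underlying object of \<open>I\<^sup>d(A)\<close> is the image of \<open>f\<^bsup>[d]\<^esup>\<close>, so
  \<open>I\<^sup>d(A) = 0\<close> iff \<open>f\<^bsup>[d]\<^esup> = 0\<close>. Associativity gives \<open>f\<^bsup>[d]\<^esup> = f \<eta>\<^bsup>[d]\<^esup>\<close>, which vanishes if \<open>\<eta>\<^bsup>[d]\<^esup>\<close> does.
  Conversely, the free object on \<open>X\<close>, with underlying object \<open>X \<oplus> F(X)\<close> and inclusions \<open>i\<close>, \<open>j\<close>,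
  satisfies \<open>f\<^bsup>[d]\<^esup> F\<^sup>d(i) = j \<eta>\<^bsup>[d]\<^esup>\<close> at \<open>X\<close>, so \<open>f\<^bsup>[d]\<^esup> = 0\<close> forces \<open>\<eta>\<^bsup>[d]\<^esup>\<close> to vanish there.
\<close>

section \<open>Abelian categories\<close>

lemma HomD:
  assumes "f \<in> Hom C a b"
  shows "f \<in> Arr C" "Dom C f = a" "Cod C f = b"
  using assms by (auto simp: Hom_def)

lemma monic_cancel:
  assumes "monic C f" "f \<in> Hom C a b" "g \<in> Hom C x a" "h \<in> Hom C x a"
    and "f \<cdot>\<^bsub>C\<^esub> g = f \<cdot>\<^bsub>C\<^esub> h"
  shows "g = h"
  using assms unfolding monic_def Hom_def by auto

lemma epic_cancel:
  assumes "epic C f" "f \<in> Hom C a b" "g \<in> Hom C b x" "h \<in> Hom C b x"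
    and "g \<cdot>\<^bsub>C\<^esub> f = h \<cdot>\<^bsub>C\<^esub> f"
  shows "g = h"
  using assms unfolding epic_def Hom_def by auto

section \<open>Composites and identities as monic and epic arrows\<close>

context category
begin

lemma Hom_Obj:
  assumes "f \<in> Hom C a b"
  shows "a \<in> Obj C" "b \<in> Obj C"
  using assms Dom_Obj Cod_Obj by (auto simp: Hom_def)

lemma monic_Comp:
  assumes f: "f \<in> Hom C a b" "monic C f" and g: "g \<in> Hom C b c" "monic C g"
  shows "monic C (g \<cdot> f)"
  unfolding monic_def
proof (intro conjI allI ballI impI)
  have gf: "g \<cdot> f \<in> Hom C a c"
    using f g by (blast intro: Comp_Hom)
  then show "g \<cdot> f \<in> Arr C" by (rule HomD)
  fix x u v
  assume "u \<in> Hom C x (Dom C (g \<cdot> f))" "v \<in> Hom C x (Dom C (g \<cdot> f))"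
    and e: "g \<cdot> f \<cdot> u = g \<cdot> f \<cdot> v"
  then have u: "u \<in> Hom C x a" and v: "v \<in> Hom C x a"
    using HomD[OF gf] by auto
  have "g \<cdot> (f \<cdot> u) = g \<cdot> (f \<cdot> v)"
    using e Comp_assoc[OF u f(1) g(1)] Comp_assoc[OF v f(1) g(1)] by simp
  then have "f \<cdot> u = f \<cdot> v"
    by (rule monic_cancel[OF g(2,1) Comp_Hom[OF u f(1)] Comp_Hom[OF v f(1)]])
  then show "u = v"
    by (rule monic_cancel[OF f(2,1) u v])
qed

lemma epic_Comp:
  assumes f: "f \<in> Hom C a b" "epic C f" and g: "g \<in> Hom C b c" "epic C g"
  shows "epic C (g \<cdot> f)"
  unfolding epic_def
proof (intro conjI allI ballI impI)
  have gf: "g \<cdot> f \<in> Hom C a c"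
    using f g by (blast intro: Comp_Hom)
  then show "g \<cdot> f \<in> Arr C" by (rule HomD)
  fix x u v
  assume "u \<in> Hom C (Cod C (g \<cdot> f)) x" "v \<in> Hom C (Cod C (g \<cdot> f)) x"
    and e: "u \<cdot> (g \<cdot> f) = v \<cdot> (g \<cdot> f)"
  then have u: "u \<in> Hom C c x" and v: "v \<in> Hom C c x"
    using HomD[OF gf] by auto
  have "(u \<cdot> g) \<cdot> f = (v \<cdot> g) \<cdot> f"
    using e Comp_assoc[OF f(1) g(1) u] Comp_assoc[OF f(1) g(1) v] by simp
  then have "u \<cdot> g = v \<cdot> g"
    by (rule epic_cancel[OF f(2,1) Comp_Hom[OF g(1) u] Comp_Hom[OF g(1) v]])
  then show "u = v"
    by (rule epic_cancel[OF g(2,1) u v])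
qed

lemma monic_Ident: "a \<in> Obj C \<Longrightarrow> monic C (Ident C a)"
  unfolding monic_def using Ident_Comp HomD[OF Ident_Hom] by metis

lemma epic_Ident: "a \<in> Obj C \<Longrightarrow> epic C (Ident C a)"
  unfolding epic_def using Comp_Ident HomD[OF Ident_Hom] by metis

end

section \<open>Zero arrows, differences and kernels\<close>

context preadditive_category
begin

lemma Zero_Hom: "a \<in> Obj C \<Longrightarrow> b \<in> Obj C \<Longrightarrow> Zero C a b \<in> Hom C a b"
  using monoid.one_closed[OF comm_group.axioms(1)[OF hom_group, THEN comm_monoid.axioms(1)]]
  by (auto simp: hom_group_def)

lemma Add_Hom: "f \<in> Hom C a b \<Longrightarrow> g \<in> Hom C a b \<Longrightarrow> Add C f g \<in> Hom C a b"
  using monoid.m_closed[OF comm_group.axioms(1)[OF hom_group, THEN comm_monoid.axioms(1)], of a b f g]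
    Hom_Obj[of f a b]
  by (auto simp: hom_group_def)

lemma Add_Zero: "f \<in> Hom C a b \<Longrightarrow> Add C f (Zero C a b) = f"
  using monoid.r_one[OF comm_group.axioms(1)[OF hom_group, THEN comm_monoid.axioms(1)], of a b f]
    Hom_Obj[of f a b]
  by (auto simp: hom_group_def)

lemma Zero_Add: "f \<in> Hom C a b \<Longrightarrow> Add C (Zero C a b) f = f"
  using monoid.l_one[OF comm_group.axioms(1)[OF hom_group, THEN comm_monoid.axioms(1)], of a b f]
    Hom_Obj[of f a b]
  by (auto simp: hom_group_def)

lemma Add_right_cancel:
  assumes "f \<in> Hom C a b" "g \<in> Hom C a b" "h \<in> Hom C a b" "Add C f h = Add C g h"
  shows "f = g"
proof -
  interpret G: comm_group "hom_group C a b"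
    using assms(1) Hom_Obj by (blast intro: hom_group)
  show ?thesis
    using assms G.right_cancel[of h f g] by (simp add: hom_group_def)
qed

lemma Add_inverse:
  assumes "f \<in> Hom C a b"
  obtains g where "g \<in> Hom C a b" "Add C f g = Zero C a b"
proof -
  interpret G: comm_group "hom_group C a b"
    using assms Hom_Obj by (blast intro: hom_group)
  show ?thesis
    using that assms G.inv_closed[of f] G.r_inv[of f] by (simp add: hom_group_def)
qed

text \<open>An additive map sends zero to an element equal to its own double, so this shows that
  composition and \<open>F\<close> preserve zero arrows.\<close>

lemma eq_Zero_if_idem:
  assumes "f \<in> Hom C a b" "Add C f f = f"
  shows "f = Zero C a b"
proof (rule Add_right_cancel)
  show "Add C f f = Add C (Zero C a b) f"
    using assms Zero_Add[OF assms(1)] by simp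
qed (use assms(1) Zero_Hom[OF Hom_Obj[OF assms(1)]] in auto)

lemma Zero_Comp:
  assumes f: "f \<in> Hom C a b" and "c \<in> Obj C"
  shows "Zero C b c \<cdot> f = Zero C a c"
proof -
  have z: "Zero C b c \<in> Hom C b c"
    using assms Hom_Obj by (blast intro: Zero_Hom)
  show ?thesis
    using eq_Zero_if_idem[OF Comp_Hom[OF f z]] Add_Comp[OF f z z] Add_Zero[OF z] by simp
qed

lemma Comp_Zero:
  assumes f: "f \<in> Hom C b c" and "a \<in> Obj C"
  shows "f \<cdot> Zero C a b = Zero C a c"
proof -
  have z: "Zero C a b \<in> Hom C a b"
    using assms Hom_Obj by (blast intro: Zero_Hom)
  show ?thesis
    using eq_Zero_if_idem[OF Comp_Hom[OF z f]] Comp_Add[OF z z f] Add_Zero[OF z] by simp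
qed

lemma epicI:
  assumes f: "f \<in> Hom C a b"
    and zero: "\<And>y t. t \<in> Hom C b y \<Longrightarrow> t \<cdot> f = Zero C a y \<Longrightarrow> t = Zero C b y"
  shows "epic C f"
  unfolding epic_def
proof (intro conjI allI ballI impI)
  show "f \<in> Arr C" using f by (rule HomD)
  fix y g h
  assume "g \<in> Hom C (Cod C f) y" "h \<in> Hom C (Cod C f) y" and e: "g \<cdot> f = h \<cdot> f"
  then have g: "g \<in> Hom C b y" and h: "h \<in> Hom C b y"
    using HomD[OF f] by auto
  \<comment> \<open>\<open>k\<close> is the additive inverse of \<open>h\<close>, so
    \<open>Add C g k\<close> is the difference of \<open>g\<close> and \<open>h\<close>.\<close>
  obtain k where k: "k \<in> Hom C b y" "Add C h k = Zero C b y"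
    using Add_inverse[OF h] .
  have "Add C g k \<cdot> f = Zero C a y"
    using Add_Comp[OF f g k(1)] Add_Comp[OF f h k(1)] k(2) e Zero_Comp[OF f, of y]
      Hom_Obj[OF g] by simp
  then have "Add C g k = Zero C b y"
    by (rule zero[OF Add_Hom[OF g k(1)]])
  then show "g = h"
    using Add_right_cancel[OF g h k(1)] k(2) by simp
qed

lemma kernelD:
  assumes "is_kernel C k f" "f \<in> Hom C a b" "k \<in> Hom C e a"
  shows "f \<cdot> k = Zero C e b"
    and "\<And>x t. t \<in> Hom C x a \<Longrightarrow> f \<cdot> t = Zero C x b \<Longrightarrow> \<exists>u \<in> Hom C x e. k \<cdot> u = t"
  using assms(1) HomD[OF assms(2)] HomD[OF assms(3)] unfolding is_kernel_def by blast+

text \<open>Arrows with the same composite with \<open>k\<close> are factorizations of one arrow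
  through the kernel, and these are unique.\<close>

lemma kernel_monic:
  assumes "is_kernel C k f"
  shows "monic C k"
  unfolding monic_def
proof (intro conjI allI ballI impI)
  have f: "f \<in> Hom C (Dom C f) (Cod C f)" and k: "k \<in> Hom C (Dom C k) (Dom C f)"
    using assms by (auto simp: is_kernel_def Hom_def)
  then show "k \<in> Arr C" by (auto simp: Hom_def)
  fix x g h
  assume g: "g \<in> Hom C x (Dom C k)" and h: "h \<in> Hom C x (Dom C k)" and e: "k \<cdot> g = k \<cdot> h"
  have "f \<cdot> (k \<cdot> g) = Zero C x (Cod C f)"
    using Comp_assoc[OF g k f] kernelD(1)[OF assms f k] Zero_Comp[OF g, of "Cod C f"] Hom_Obj[OF f]
    by simp
  then have "\<exists>!u. u \<in> Hom C x (Dom C k) \<and> k \<cdot> u = k \<cdot> g"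
    using assms Comp_Hom[OF g k] by (auto simp: is_kernel_def)
  then show "g = h"
    using g h e by metis
qed

end

section \<open>Images, and epic arrows in right exact sequences\<close>

context abelian_category
begin

text \<open>The image is the kernel of the cokernel of \<open>f\<close>. The induced
  \<open>q\<close> is epic because a subobject of the image through which \<open>f\<close> factors
  must be the whole image.\<close>

lemma image_factorization_exists:
  assumes f: "f \<in> Hom C a b"
  obtains e q i where "image_factorization C f e q i"
proof -
  obtain c where c: "is_cokernel C c f"
    using cokernels HomD(1)[OF f] by blast
  define y where "y = Cod C c"
  have cH: "c \<in> Hom C b y" and cf: "c \<cdot> f = Zero C a y"
    and cu: "\<And>z t. t \<in> Hom C b z \<Longrightarrow> t \<cdot> f = Zero C a z \<Longrightarrow> \<exists>u \<in> Hom C y z. u \<cdot> c = t"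
    using c HomD[OF f] unfolding is_cokernel_def y_def by (simp_all add: Hom_def) blast
  obtain i where i: "is_kernel C i c"
    using kernels HomD(1)[OF cH] by blast
  define e where "e = Dom C i"
  have iH: "i \<in> Hom C e b"
    using i HomD[OF cH] by (auto simp: is_kernel_def Hom_def e_def)
  obtain q where qH: "q \<in> Hom C a e" and iq: "i \<cdot> q = f"
    using kernelD(2)[OF i cH iH f cf] by blast
  have "epic C q"
  proof (rule epicI[OF qH])
    fix z t
    assume t: "t \<in> Hom C e z" and tq: "t \<cdot> q = Zero C a z"
    \<comment> \<open>Since \<open>m\<close> is killed by \<open>t\<close>, it suffices to find a
      right inverse of \<open>m\<close>.\<close>
    obtain m where m: "is_kernel C m t"
      using kernels HomD(1)[OF t] by blast
    define s where "s = Dom C m"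
    have mH: "m \<in> Hom C s e"
      using m HomD[OF t] by (auto simp: is_kernel_def Hom_def s_def)
    obtain q' where q': "q' \<in> Hom C a s" "m \<cdot> q' = q"
      using kernelD(2)[OF m t mH qH tq] by blast
    have imH: "i \<cdot> m \<in> Hom C s b"
      by (rule Comp_Hom[OF mH iH])
    \<comment> \<open>The monic \<open>i \<cdot> m\<close> is the kernel of some \<open>h\<close>.
      This \<open>h\<close> kills \<open>f\<close>, hence factors through \<open>c\<close>, hence
      kills \<open>i\<close>, so \<open>i\<close> factors through
      \<open>i \<cdot> m\<close>.\<close>
    obtain h where h: "is_kernel C (i \<cdot> m) h"
      using monic_kernel monic_Comp[OF mH kernel_monic[OF m] iH kernel_monic[OF i]] by blast
    define w where "w = Cod C h"
    have hH: "h \<in> Hom C b w"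
      using h HomD[OF imH] by (auto simp: is_kernel_def Hom_def w_def)
    note w = Hom_Obj(2)[OF hH]
    have "h \<cdot> f = h \<cdot> (i \<cdot> m \<cdot> q')"
      using Comp_assoc[OF q'(1) mH iH] iq q'(2) by simp
    also have "\<dots> = Zero C a w"
      using Comp_assoc[OF q'(1) imH hH] kernelD(1)[OF h hH imH] Zero_Comp[OF q'(1) w] by simp
    finally obtain h' where h': "h' \<in> Hom C y w" "h' \<cdot> c = h"
      using cu[OF hH] by blast
    have "h \<cdot> i = Zero C e w"
      using Comp_assoc[OF iH cH h'(1)] h'(2) kernelD(1)[OF i cH iH]
        Comp_Zero[OF h'(1) Hom_Obj(1)[OF iH]] by simp
    then obtain r where r: "r \<in> Hom C e s" "i \<cdot> m \<cdot> r = i"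
      using kernelD(2)[OF h hH imH iH] by blast
    have id: "Ident C e \<in> Hom C e e"
      by (rule Ident_Hom[OF Hom_Obj(1)[OF iH]])
    have "i \<cdot> (m \<cdot> r) = i \<cdot> Ident C e"
      using Comp_assoc[OF r(1) mH iH] r(2) Comp_Ident[OF iH] by simp
    then have "m \<cdot> r = Ident C e"
      by (rule monic_cancel[OF kernel_monic[OF i] iH Comp_Hom[OF r(1) mH] id])
    then have "t = t \<cdot> m \<cdot> r"
      using Comp_assoc[OF r(1) mH t] Comp_Ident[OF t] by simp
    then show "t = Zero C e z"
      using kernelD(1)[OF m t mH] Zero_Comp[OF r(1) Hom_Obj(2)[OF t]] by simp
  qed
  then have "image_factorization C f e q i"
    unfolding image_factorization_def
    using HomD[OF f] qH iH kernel_monic[OF i] iq by simp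
  then show ?thesis by (rule that)
qed

text \<open>Right exactness of a functor speaks of sequences, so an epic arrow is completed by its
  kernel to a sequence on which that hypothesis can act.\<close>

lemma epic_right_exact:
  assumes e: "epic C e"
  obtains k where "right_exact_sequence C k e"
proof -
  have eH: "e \<in> Hom C (Dom C e) (Cod C e)"
    using e by (auto simp: epic_def Hom_def)
  obtain k where k: "is_kernel C k e"
    using kernels HomD(1)[OF eH] by blast
  have kH: "k \<in> Hom C (Dom C k) (Dom C e)"
    using k by (auto simp: is_kernel_def Hom_def)
  note o = Hom_Obj(1)[OF kH]
  \<comment> \<open>A kernel is monic, so it is its own image, with the identity as epic
    part.\<close>
  have "image_factorization C k (Dom C k) (Ident C (Dom C k)) k"
    unfolding image_factorization_def
    using Ident_Hom[OF o] epic_Ident[OF o] kernel_monic[OF k] kH HomD(3)[OF kH] Comp_Ident[OF kH]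
    by simp
  then have "exact_pair C k e"
    unfolding exact_pair_def using k by (auto simp: is_kernel_def)
  then show ?thesis
    using that e by (auto simp: right_exact_sequence_def)
qed

end

section \<open>Iterated images in an extension\<close>

locale associative_extension =
  abelian_category C + endo: additive_functor C C F +
  mult: natural_transformation C C "functor_power F 2" F \<eta>
  for C :: "('o, 'm, 'z) addcat_scheme" (structure)
    and F :: "('o, 'm, 'o, 'm) func" and \<eta> :: "'o \<Rightarrow> 'm" +
  assumes right_exact: "preserves_right_exact_sequences C C F"
    and associative: "associative_multiplication C F \<eta>"
begin

abbreviation \<A> where "\<A> \<equiv> eta_extension C F \<eta>"

lemmas F_Hom = endo.AMap_Hom
lemmas F_Comp = endo.AMap_Comp

section \<open>Calculation rules for \<open>F\<close> and \<eta>\<close>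

lemma \<eta>_Hom: "a \<in> Obj C \<Longrightarrow> \<eta> a \<in> Hom C (OMap F (OMap F a)) (OMap F a)"
  using mult.component_Hom[of a] by (simp add: numeral_2_eq_2 functor_comp_def functor_id_def)

lemma \<eta>_natural: "f \<in> Hom C a b \<Longrightarrow> \<eta> b \<cdot> AMap F (AMap F f) = AMap F f \<cdot> \<eta> a"
  using mult.naturality[of f a b] by (simp add: numeral_2_eq_2 functor_comp_def functor_id_def)

lemma \<eta>_associative: "a \<in> Obj C \<Longrightarrow> \<eta> a \<cdot> AMap F (\<eta> a) = \<eta> a \<cdot> \<eta> (OMap F a)"
  using associative
  by (simp add: associative_multiplication_def vertical_comp_def whisker_left_def whisker_right_def)

lemma F_Zero:
  assumes "a \<in> Obj C" "b \<in> Obj C"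
  shows "AMap F (Zero C a b) = Zero C (OMap F a) (OMap F b)"
proof -
  have z: "Zero C a b \<in> Hom C a b"
    using assms by (rule Zero_Hom)
  show ?thesis
    using eq_Zero_if_idem[OF F_Hom[OF z]] endo.AMap_Add[OF z z] Add_Zero[OF z] by simp
qed

lemma F_epic: "epic C e \<Longrightarrow> epic C (AMap F e)"
  using epic_right_exact right_exact
  unfolding preserves_right_exact_sequences_def right_exact_sequence_def by metis

section \<open>Objects, arrows and zero objects of the extension\<close>

lemma eta_objectsD:
  assumes "(b, f) \<in> Obj \<A>"
  shows "b \<in> Obj C" "f \<in> Hom C (OMap F b) b" "f \<cdot> AMap F f = f \<cdot> \<eta> b"
  using assms by (auto simp: eta_extension_def eta_objects_def)

lemma Hom_extension:
  "t \<in> Hom \<A> (b, f) (b', f') \<longleftrightarrow>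
     (b, f) \<in> Obj \<A> \<and> (b', f') \<in> Obj \<A> \<and>
     (\<exists>\<alpha> \<in> Hom C b b'. \<alpha> \<cdot> f = f' \<cdot> AMap F \<alpha> \<and> t = ((b, f), \<alpha>, (b', f')))"
  unfolding eta_extension_def by (auto simp: Hom_def)

text \<open>A zero arrow commutes with any two actions, so on a zero object it must coincide with
  the identity; an identity that is zero makes every arrow out of or into \<open>b\<close>
  zero.\<close>

lemma zero_object_extension_iff:
  assumes A: "(b, f) \<in> Obj \<A>"
  shows "zero_object \<A> (b, f) \<longleftrightarrow> Ident C b = Zero C b b"
proof
  note b = eta_objectsD[OF A]
  note id = Ident_Hom[OF b(1)] and zero = Zero_Hom[OF b(1,1)]
  note Fb = Hom_Obj(1)[OF b(2)]
  have zero_arrow: "((b, f), Zero C b b', (b', f')) \<in> Hom \<A> (b, f) (b', f')"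
    "((b', f'), Zero C b' b, (b, f)) \<in> Hom \<A> (b', f') (b, f)"
    if A': "(b', f') \<in> Obj \<A>" for b' f'
  proof -
    note b' = eta_objectsD[OF A']
    note Fb' = Hom_Obj(1)[OF b'(2)]
    show "((b, f), Zero C b b', (b', f')) \<in> Hom \<A> (b, f) (b', f')"
      "((b', f'), Zero C b' b, (b, f)) \<in> Hom \<A> (b', f') (b, f)"
      unfolding Hom_extension
      using A A' Zero_Hom b b' Fb Fb' Zero_Comp[OF b(2)] Zero_Comp[OF b'(2)]
        Comp_Zero[OF b(2)] Comp_Zero[OF b'(2)] F_Zero
      by auto
  qed
  {
    assume "zero_object \<A> (b, f)"
    then have "\<exists>!t. t \<in> Hom \<A> (b, f) (b, f)"
      using A unfolding zero_object_def by blast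
    moreover have "((b, f), Ident C b, (b, f)) \<in> Hom \<A> (b, f) (b, f)"
      unfolding Hom_extension
      using A id endo.AMap_Ident[OF b(1)] Comp_Ident[OF b(2)] Ident_Comp[OF b(2)] by auto
    ultimately have "((b, f), Ident C b, (b, f)) = ((b, f), Zero C b b, (b, f))"
      using zero_arrow(1)[OF A] by blast
    then show "Ident C b = Zero C b b" by simp
  next
    assume z: "Ident C b = Zero C b b"
    have "\<alpha> = Zero C b b'" if "\<alpha> \<in> Hom C b b'" for \<alpha> b'
      using Comp_Ident[OF that] Comp_Zero[OF that b(1)] z by simp
    moreover have "\<alpha> = Zero C b' b" if "\<alpha> \<in> Hom C b' b" for \<alpha> b'
      using Ident_Comp[OF that] Zero_Comp[OF that b(1)] z by simp
    ultimately have "(\<exists>!t. t \<in> Hom \<A> (b, f) (b', f')) \<and> (\<exists>!t. t \<in> Hom \<A> (b', f') (b, f))"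
      if "(b', f') \<in> Obj \<A>" for b' f'
      using zero_arrow[OF that] unfolding Hom_extension by blast
    then show "zero_object \<A> (b, f)"
      unfolding zero_object_def using A by (metis surj_pair)
  }
qed

section \<open>Powers of the multiplication and of an action\<close>

lemma mult_power_Hom:
  "a \<in> Obj C \<Longrightarrow> mult_power C F \<eta> (Suc r) a \<in> Hom C (OMap (functor_power F (Suc r)) a) (OMap F a)"
proof (induction r)
  case 0
  then show ?case
    by (simp add: id_transformation_def functor_comp_def functor_id_def Ident_Hom endo.OMap_Obj)
next
  case (Suc r)
  then show ?case
    using Comp_Hom[OF F_Hom[OF Suc.IH[OF Suc.prems]] \<eta>_Hom[OF Suc.prems]]
    by (simp add: vertical_comp_def whisker_left_def functor_comp_def)
qed

lemma functor_power_Hom: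
  "f \<in> Hom C a b \<Longrightarrow>
     AMap (functor_power F r) f \<in> Hom C (OMap (functor_power F r) a) (OMap (functor_power F r) b)"
  by (induction r) (auto simp: functor_comp_def functor_id_def F_Hom)

text \<open>Unlike for \<open>mult_power\<close>, exponent 0 is meaningful here: the identity starts
  the induction over iterated images.\<close>

primrec action_power :: "'o \<Rightarrow> 'm \<Rightarrow> nat \<Rightarrow> 'm" where
  "action_power b f 0 = Ident C b"
| "action_power b f (Suc r) = f \<cdot> AMap F (action_power b f r)"

lemma action_power_Hom:
  assumes "(b, f) \<in> Obj \<A>"
  shows "action_power b f r \<in> Hom C (OMap (functor_power F r) b) b"
proof (induction r)
  case 0
  then show ?case
    using eta_objectsD(1)[OF assms] by (simp add: functor_id_def Ident_Hom)
next
  case (Suc r)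
  then show ?case
    using Comp_Hom[OF F_Hom[OF Suc] eta_objectsD(2)[OF assms]] by (simp add: functor_comp_def)
qed

text \<open>Each step replaces \<open>f \<cdot> AMap F f\<close> by
  \<open>f \<cdot> \<eta> b\<close>, the associativity of the action. The exponent is a successor
  since \<open>mult_power\<close> at 0 is unspecified.\<close>

lemma action_power_eq_mult_power:
  assumes A: "(b, f) \<in> Obj \<A>"
  shows "action_power b f (Suc r) = f \<cdot> mult_power C F \<eta> (Suc r) b"
proof (induction r)
  case 0
  show ?case
    using endo.AMap_Ident[OF eta_objectsD(1)[OF A]] by (simp add: id_transformation_def)
next
  case (Suc r)
  note b = eta_objectsD[OF A]
  let ?m = "mult_power C F \<eta> (Suc r) b"
  note m = mult_power_Hom[OF b(1), of r]
  note Fm = F_Hom[OF m]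
  have "action_power b f (Suc (Suc r)) = f \<cdot> AMap F (f \<cdot> ?m)"
    using Suc by simp
  also have "\<dots> = (f \<cdot> AMap F f) \<cdot> AMap F ?m"
    using F_Comp[OF m b(2)] Comp_assoc[OF Fm F_Hom[OF b(2)] b(2)] by simp
  also have "\<dots> = f \<cdot> (\<eta> b \<cdot> AMap F ?m)"
    using b(3) Comp_assoc[OF Fm \<eta>_Hom[OF b(1)] b(2)] by simp
  finally show ?case
    by (simp add: vertical_comp_def whisker_left_def)
qed

section \<open>Iterated images as images of powers of the action\<close>

lemma subobject_in_extension:
  assumes A: "(b, f) \<in> Obj \<A>"
    and i: "i \<in> Hom C c b" "monic C i" and g: "g \<in> Hom C (OMap F c) c"
    and ig: "i \<cdot> g = f \<cdot> AMap F i"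
  shows "(c, g) \<in> Obj \<A>"
proof -
  note b = eta_objectsD[OF A]
  note c = Hom_Obj(1)[OF i(1)]
  note Fi = F_Hom[OF i(1)] and Fg = F_Hom[OF g] and Ff = F_Hom[OF b(2)]
    and \<eta>c = \<eta>_Hom[OF c] and \<eta>b = \<eta>_Hom[OF b(1)]
  note FFi = F_Hom[OF Fi]
  \<comment> \<open>Associativity of \<open>g\<close> is tested after the monic \<open>i\<close>,
    where \<open>ig\<close> turns it into associativity of \<open>f\<close> and naturality of \<eta>
    at \<open>i\<close>.\<close>
  have "i \<cdot> (g \<cdot> AMap F g) = f \<cdot> AMap F i \<cdot> AMap F g"
    using Comp_assoc[OF Fg g i(1)] ig by simp
  also have "\<dots> = f \<cdot> AMap F (f \<cdot> AMap F i)"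
    using Comp_assoc[OF Fg Fi b(2)] F_Comp[OF g i(1)] ig by simp
  also have "\<dots> = f \<cdot> \<eta> b \<cdot> AMap F (AMap F i)"
    using F_Comp[OF Fi b(2)] Comp_assoc[OF FFi Ff b(2)] b(3) by simp
  also have "\<dots> = f \<cdot> (AMap F i \<cdot> \<eta> c)"
    using Comp_assoc[OF FFi \<eta>b b(2)] \<eta>_natural[OF i(1)] by simp
  also have "\<dots> = i \<cdot> (g \<cdot> \<eta> c)"
    using Comp_assoc[OF \<eta>c Fi b(2)] Comp_assoc[OF \<eta>c g i(1)] ig by simp
  finally have "g \<cdot> AMap F g = g \<cdot> \<eta> c"
    by (rule monic_cancel[OF i(2,1) Comp_Hom[OF Fg g] Comp_Hom[OF \<eta>c g]])
  then show ?thesis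
    using c g by (simp add: eta_extension_def eta_objects_def)
qed

lemma image_object_cases:
  assumes "(b, f) \<in> Obj \<A>"
  obtains e q i where "image_object C F (b, f) = (e, q \<cdot> AMap F i)"
    and "q \<in> Hom C (OMap F b) e" "epic C q" "i \<in> Hom C e b" "monic C i" "f = i \<cdot> q"
proof -
  note f = eta_objectsD(2)[OF assms]
  obtain e' q' i' where "image_factorization C f e' q' i'"
    using image_factorization_exists[OF f] .
  \<comment> \<open>The chosen triple is named first; the existing factorization
    \<open>(e', q', i')\<close> then shows that the choice is a factorization too.\<close>
  moreover obtain e q i where some: "(SOME (e, q, i). image_factorization C f e q i) = (e, q, i)"
    by (metis prod_cases3)
  ultimately have "image_factorization C f e q i"
    using someI[of "\<lambda>(e, q, i). image_factorization C f e q i" "(e', q', i')"] by simp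
  then show ?thesis
    using that[of e q i] some HomD[OF f] by (simp add: image_object_def image_factorization_def)
qed

text \<open>\<open>i \<cdot> q\<close> is an image factorization of the action power. The equation
  \<open>i \<cdot> g = f \<cdot> AMap F i\<close> makes the inclusion a morphism of the extension
  and carries the induction to the next power.\<close>

lemma iterated_image:
  assumes A: "(b, f) \<in> Obj \<A>"
  obtains c g q i where "(image_object C F ^^ r) (b, f) = (c, g)" "(c, g) \<in> Obj \<A>"
    and "q \<in> Hom C (OMap (functor_power F r) b) c" "epic C q"
    and "i \<in> Hom C c b" "monic C i"
    and "i \<cdot> g = f \<cdot> AMap F i" "action_power b f r = i \<cdot> q"
proof -
  note b = eta_objectsD[OF A]
  have "\<exists>c g q i. (image_object C F ^^ r) (b, f) = (c, g) \<and> (c, g) \<in> Obj \<A> \<and>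
    q \<in> Hom C (OMap (functor_power F r) b) c \<and> epic C q \<and> i \<in> Hom C c b \<and> monic C i \<and>
    i \<cdot> g = f \<cdot> AMap F i \<and> action_power b f r = i \<cdot> q"
  proof (induction r)
    case 0
    \<comment> \<open>Before any image is taken, the identity is both the epic and the monic
      part.\<close>
    let ?I = "Ident C b"
    have "?I \<in> Hom C (OMap (functor_power F 0) b) b"
      using Ident_Hom[OF b(1)] by (simp add: functor_id_def)
    moreover have "?I \<cdot> f = f \<cdot> AMap F ?I"
      using Ident_Comp[OF b(2)] Comp_Ident[OF b(2)] endo.AMap_Ident[OF b(1)] by simp
    moreover have "?I = ?I \<cdot> ?I"
      using Ident_Comp[OF Ident_Hom[OF b(1)]] by simp
    ultimately show ?case
      using A Ident_Hom[OF b(1)] epic_Ident[OF b(1)] monic_Ident[OF b(1)]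
      by (intro exI[of _ b] exI[of _ f] exI[of _ ?I]) simp
  next
    case (Suc r)
    then obtain c g q i where
      iter: "(image_object C F ^^ r) (b, f) = (c, g)" and cg: "(c, g) \<in> Obj \<A>"
      and q: "q \<in> Hom C (OMap (functor_power F r) b) c" "epic C q"
      and i: "i \<in> Hom C c b" "monic C i"
      and ig: "i \<cdot> g = f \<cdot> AMap F i" and p: "action_power b f r = i \<cdot> q"
      by blast
    note c = eta_objectsD[OF cg]
    obtain e q' i' where
      im: "image_object C F (c, g) = (e, q' \<cdot> AMap F i')"
      and q': "q' \<in> Hom C (OMap F c) e" "epic C q'"
      and i': "i' \<in> Hom C e c" "monic C i'" and g: "g = i' \<cdot> q'"
      using image_object_cases[OF cg] .
    note Fi = F_Hom[OF i(1)] and Fi' = F_Hom[OF i'(1)] and Fq = F_Hom[OF q(1)]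
    note ii' = Comp_Hom[OF i'(1) i(1)]
    note qFi' = Comp_Hom[OF Fi' q'(1)]
    \<comment> \<open>This equation is both the invariant for the next image and the input of
      \<open>subobject_in_extension\<close>.\<close>
    have "i \<cdot> i' \<cdot> (q' \<cdot> AMap F i') = i \<cdot> g \<cdot> AMap F i'"
      using Comp_assoc[OF Fi' q'(1) ii'] Comp_assoc[OF q'(1) i'(1) i(1)] g by simp
    also have "\<dots> = f \<cdot> AMap F (i \<cdot> i')"
      using ig Comp_assoc[OF Fi' Fi b(2)] F_Comp[OF i'(1) i(1)] by simp
    finally have act: "i \<cdot> i' \<cdot> (q' \<cdot> AMap F i') = f \<cdot> AMap F (i \<cdot> i')" .
    have "action_power b f (Suc r) = f \<cdot> AMap F i \<cdot> AMap F q"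
      using p F_Comp[OF q(1) i(1)] Comp_assoc[OF Fq Fi b(2)] by simp
    also have "\<dots> = i \<cdot> i' \<cdot> q' \<cdot> AMap F q"
      using ig g Comp_assoc[OF q'(1) i'(1) i(1)] by simp
    also have "\<dots> = i \<cdot> i' \<cdot> (q' \<cdot> AMap F q)"
      using Comp_assoc[OF Fq q'(1) ii'] by simp
    finally have pow: "action_power b f (Suc r) = i \<cdot> i' \<cdot> (q' \<cdot> AMap F q)" .
    note mono = monic_Comp[OF i' i]
    show ?case
    proof (intro exI conjI)
      show "(image_object C F ^^ Suc r) (b, f) = (e, q' \<cdot> AMap F i')"
        using iter im by simp
      show "(e, q' \<cdot> AMap F i') \<in> Obj \<A>"
        by (rule subobject_in_extension[OF A ii' mono qFi' act])
      show "q' \<cdot> AMap F q \<in> Hom C (OMap (functor_power F (Suc r)) b) e"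
        using Comp_Hom[OF Fq q'(1)] by (simp add: functor_comp_def)
      \<comment> \<open>Right exactness of \<open>F\<close> enters here: it keeps
        \<open>AMap F q\<close> epic.\<close>
      show "epic C (q' \<cdot> AMap F q)"
        by (rule epic_Comp[OF Fq F_epic[OF q(2)] q'])
    qed (fact ii' mono act pow)+
  qed
  then show ?thesis using that by blast
qed

text \<open>An epic arrow followed by a monic one vanishes only if the object between them is zero,
  which \<open>zero_object_extension_iff\<close> tests in the base category.\<close>

lemma iterated_image_zero_iff:
  assumes A: "(b, f) \<in> Obj \<A>"
  shows "zero_object \<A> ((image_object C F ^^ r) (b, f)) \<longleftrightarrow>
    action_power b f r = Zero C (OMap (functor_power F r) b) b"
proof -
  obtain c g q i where iter: "(image_object C F ^^ r) (b, f) = (c, g)" and cg: "(c, g) \<in> Obj \<A>"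
    and q: "q \<in> Hom C (OMap (functor_power F r) b) c" "epic C q"
    and i: "i \<in> Hom C c b" "monic C i" and p: "action_power b f r = i \<cdot> q"
    using iterated_image[OF A, of r] by metis
  note o = Hom_Obj[OF q(1)] Hom_Obj(2)[OF i(1)]
  have "Ident C c = Zero C c c \<longleftrightarrow> i \<cdot> q = Zero C (OMap (functor_power F r) b) b"
  proof
    assume "Ident C c = Zero C c c"
    then have "i = Zero C c b"
      using Comp_Ident[OF i(1)] Comp_Zero[OF i(1) o(2)] by simp
    then show "i \<cdot> q = Zero C (OMap (functor_power F r) b) b"
      using Zero_Comp[OF q(1) o(3)] by simp
  next
    assume "i \<cdot> q = Zero C (OMap (functor_power F r) b) b"
    then have "i \<cdot> q = i \<cdot> Zero C (OMap (functor_power F r) b) c"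
      using Comp_Zero[OF i(1) o(1)] by simp
    then have "q = Zero C (OMap (functor_power F r) b) c"
      by (rule monic_cancel[OF i(2,1) q(1) Zero_Hom[OF o(1,2)]])
    then have "Ident C c \<cdot> q = Zero C c c \<cdot> q"
      using Ident_Comp[OF q(1)] Zero_Comp[OF q(1) o(2)] by simp
    then show "Ident C c = Zero C c c"
      by (rule epic_cancel[OF q(2,1) Ident_Hom[OF o(2)] Zero_Hom[OF o(2,2)]])
  qed
  then show ?thesis
    using iter zero_object_extension_iff[OF cg] p by simp
qed

section \<open>Free objects and the equivalence\<close>

text \<open>The action on \<open>X \<oplus> F(X)\<close> is \<open>j (F(p) + \<eta> F(q))\<close>, where \<open>p\<close> and \<open>q\<close> are the projections.\<close>

lemma free_object:
  assumes a: "a \<in> Obj C"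
  obtains s f i j q where "(s, f) \<in> Obj \<A>"
    and "i \<in> Hom C a s" "j \<in> Hom C (OMap F a) s" "q \<in> Hom C s (OMap F a)"
    and "q \<cdot> j = Ident C (OMap F a)"
    and "f \<cdot> AMap F i = j" "f \<cdot> AMap F j = j \<cdot> \<eta> a"
proof -
  note Fa = endo.OMap_Obj[OF a]
  obtain s i j p q where bip: "is_biproduct C a (OMap F a) s i j p q"
    using biproducts[OF a Fa] by blast
  then have i: "i \<in> Hom C a s" and j: "j \<in> Hom C (OMap F a) s"
    and p: "p \<in> Hom C s a" and q: "q \<in> Hom C s (OMap F a)"
    and pi: "p \<cdot> i = Ident C a" and qj: "q \<cdot> j = Ident C (OMap F a)"
    and pj: "p \<cdot> j = Zero C (OMap F a) a" and qi: "q \<cdot> i = Zero C a (OMap F a)"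
    by (auto simp: is_biproduct_def)
  note s = Hom_Obj(2)[OF i]
  note Fi = F_Hom[OF i] and Fj = F_Hom[OF j] and Fp = F_Hom[OF p] and Fq = F_Hom[OF q]
  note FFp = F_Hom[OF Fp] and FFq = F_Hom[OF Fq]
  note \<eta>a = \<eta>_Hom[OF a] and \<eta>s = \<eta>_Hom[OF s]
  note F\<eta> = F_Hom[OF \<eta>a] and \<eta>F = \<eta>_Hom[OF Fa]
  note \<eta>Fq = Comp_Hom[OF Fq \<eta>a]
  \<comment> \<open>Before \<open>j\<close> includes its values in \<open>s\<close>, the action is
    \<open>g\<close>, which restricts to the identity along \<open>AMap F i\<close> and to
    \<open>\<eta> a\<close> along \<open>AMap F j\<close>.\<close>
  define g where "g = Add C (AMap F p) (\<eta> a \<cdot> AMap F q)"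
  have g: "g \<in> Hom C (OMap F s) (OMap F a)"
    unfolding g_def by (rule Add_Hom[OF Fp \<eta>Fq])
  note Fg = F_Hom[OF g]
  have gi: "g \<cdot> AMap F i = Ident C (OMap F a)"
    unfolding g_def
    using Add_Comp[OF Fi Fp \<eta>Fq] F_Comp[OF i p] pi endo.AMap_Ident[OF a]
      Comp_assoc[OF Fi Fq \<eta>a] F_Comp[OF i q] qi F_Zero[OF a Fa] Comp_Zero[OF \<eta>a Fa]
      Add_Zero[OF Ident_Hom[OF Fa]]
    by simp
  have gj: "g \<cdot> AMap F j = \<eta> a"
    unfolding g_def
    using Add_Comp[OF Fj Fp \<eta>Fq] F_Comp[OF j p] pj F_Zero[OF Fa a]
      Comp_assoc[OF Fj Fq \<eta>a] F_Comp[OF j q] qj endo.AMap_Ident[OF Fa] Comp_Ident[OF \<eta>a]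
      Zero_Add[OF \<eta>a]
    by simp
  \<comment> \<open>Naturality of \<eta> settles the summand with \<open>p\<close>; the summand with
    \<open>q\<close> also needs the associativity of \<eta>.\<close>
  have \<eta>g: "\<eta> a \<cdot> AMap F g = g \<cdot> \<eta> s"
  proof -
    have "\<eta> a \<cdot> AMap F g = Add C (\<eta> a \<cdot> AMap F (AMap F p)) (\<eta> a \<cdot> AMap F (\<eta> a \<cdot> AMap F q))"
      unfolding g_def
      using endo.AMap_Add[OF Fp \<eta>Fq] Comp_Add[OF FFp F_Hom[OF \<eta>Fq] \<eta>a] by simp
    also have "\<eta> a \<cdot> AMap F (\<eta> a \<cdot> AMap F q) = \<eta> a \<cdot> (\<eta> (OMap F a) \<cdot> AMap F (AMap F q))"
      using F_Comp[OF Fq \<eta>a] Comp_assoc[OF FFq F\<eta> \<eta>a] \<eta>_associative[OF a]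
        Comp_assoc[OF FFq \<eta>F \<eta>a] by simp
    also have "\<dots> = \<eta> a \<cdot> AMap F q \<cdot> \<eta> s"
      using \<eta>_natural[OF q] Comp_assoc[OF \<eta>s Fq \<eta>a] by simp
    finally show ?thesis
      unfolding g_def using \<eta>_natural[OF p] Add_Comp[OF \<eta>s Fp \<eta>Fq] by simp
  qed
  have f: "j \<cdot> g \<in> Hom C (OMap F s) s"
    by (rule Comp_Hom[OF g j])
  have fj: "j \<cdot> g \<cdot> AMap F j = j \<cdot> \<eta> a"
    using Comp_assoc[OF Fj g j] gj by simp
  \<comment> \<open>\<open>fj\<close> reduces associativity of the action \<open>j \<cdot> g\<close>
    to the compatibility \<open>\<eta>g\<close>.\<close>
  have "j \<cdot> g \<cdot> AMap F (j \<cdot> g) = j \<cdot> \<eta> a \<cdot> AMap F g"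
    using F_Comp[OF g j] Comp_assoc[OF Fg Fj f] fj by simp
  also have "\<dots> = j \<cdot> g \<cdot> \<eta> s"
    using Comp_assoc[OF Fg \<eta>a j] \<eta>g Comp_assoc[OF \<eta>s g j] by simp
  finally have "(s, j \<cdot> g) \<in> Obj \<A>"
    using s f by (simp add: eta_extension_def eta_objects_def)
  moreover have "j \<cdot> g \<cdot> AMap F i = j"
    using Comp_assoc[OF Fi g j] gi Comp_Ident[OF j] by simp
  ultimately show ?thesis
    using that i j q qj fj by blast
qed

text \<open>Acting on \<open>i\<close> gives \<open>j\<close>, and each further action multiplies by
  \<eta>, because \<open>fj\<close> keeps the result in the summand included by
  \<open>j\<close>.\<close>

lemma action_power_generators:
  assumes A: "(s, f) \<in> Obj \<A>" and i: "i \<in> Hom C a s" and j: "j \<in> Hom C (OMap F a) s"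
    and fi: "f \<cdot> AMap F i = j" and fj: "f \<cdot> AMap F j = j \<cdot> \<eta> a"
  shows "action_power s f (Suc r) \<cdot> AMap (functor_power F (Suc r)) i = j \<cdot> mult_power C F \<eta> (Suc r) a"
proof (induction r)
  case 0
  have "f \<cdot> Ident C (OMap F s) = f"
    by (rule Comp_Ident[OF eta_objectsD(2)[OF A]])
  then show ?case
    using fi Comp_Ident[OF j] endo.AMap_Ident[OF eta_objectsD(1)[OF A]]
    by (simp add: functor_comp_def functor_id_def id_transformation_def)
next
  case (Suc r)
  note f = eta_objectsD(2)[OF A] and a = Hom_Obj(1)[OF i]
  note P = action_power_Hom[OF A, of "Suc r"] and I = functor_power_Hom[OF i, of "Suc r"]
    and M = mult_power_Hom[OF a, of r]
  note FP = F_Hom[OF P] and FI = F_Hom[OF I] and FM = F_Hom[OF M]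
  have "action_power s f (Suc (Suc r)) \<cdot> AMap (functor_power F (Suc (Suc r))) i
      = f \<cdot> AMap F (action_power s f (Suc r)) \<cdot> AMap F (AMap (functor_power F (Suc r)) i)"
    by (simp add: functor_comp_def)
  also have "\<dots> = f \<cdot> AMap F (j \<cdot> mult_power C F \<eta> (Suc r) a)"
    unfolding Comp_assoc[OF FI FP f, symmetric] F_Comp[OF I P, symmetric] Suc ..
  also have "\<dots> = j \<cdot> \<eta> a \<cdot> AMap F (mult_power C F \<eta> (Suc r) a)"
    unfolding F_Comp[OF M j] Comp_assoc[OF FM F_Hom[OF j] f] fj ..
  also have "\<dots> = j \<cdot> (\<eta> a \<cdot> AMap F (mult_power C F \<eta> (Suc r) a))"
    by (rule Comp_assoc[OF FM \<eta>_Hom[OF a] j, symmetric])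
  finally show ?case
    by (simp add: vertical_comp_def whisker_left_def)
qed

text \<open>The exponent is a successor so that \<open>mult_power\<close> is specified. One
  direction evaluates on free objects; the other uses that an action power factors through the power
  of \<eta>.\<close>

lemma uniformly_image_nilpotent_iff:
  "uniformly_image_nilpotent C F \<eta> (Suc r) \<longleftrightarrow>
     is_zero_transformation C C (functor_power F (Suc r)) F (mult_power C F \<eta> (Suc r))"
proof
  assume nil: "uniformly_image_nilpotent C F \<eta> (Suc r)"
  show "is_zero_transformation C C (functor_power F (Suc r)) F (mult_power C F \<eta> (Suc r))"
    unfolding is_zero_transformation_def
  proof
    fix a assume a: "a \<in> Obj C"
    let ?m = "mult_power C F \<eta> (Suc r) a" and ?Fa = "OMap (functor_power F (Suc r)) a"
    obtain s f i j q where A: "(s, f) \<in> Obj \<A>"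
      and i: "i \<in> Hom C a s" and j: "j \<in> Hom C (OMap F a) s" and q: "q \<in> Hom C s (OMap F a)"
      and qj: "q \<cdot> j = Ident C (OMap F a)"
      and fi: "f \<cdot> AMap F i = j" and fj: "f \<cdot> AMap F j = j \<cdot> \<eta> a"
      using free_object[OF a] .
    note m = mult_power_Hom[OF a, of r]
    have "action_power s f (Suc r) = Zero C (OMap (functor_power F (Suc r)) s) s"
      using nil A iterated_image_zero_iff[OF A] unfolding uniformly_image_nilpotent_def by blast
    then have "j \<cdot> ?m = Zero C ?Fa s"
      using action_power_generators[OF A i j fi fj, of r]
        Zero_Comp[OF functor_power_Hom[OF i] eta_objectsD(1)[OF A]] by metis
    \<comment> \<open>The projection \<open>q\<close> is a left inverse of \<open>j\<close>, so
      nothing is lost in passing to \<open>s\<close>.\<close>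
    then have "q \<cdot> (j \<cdot> ?m) = Zero C ?Fa (OMap F a)"
      using Comp_Zero[OF q Hom_Obj(1)[OF m]] by simp
    then show "?m = Zero C ?Fa (OMap F a)"
      using Comp_assoc[OF m j q] qj Ident_Comp[OF m] by simp
  qed
next
  assume zero: "is_zero_transformation C C (functor_power F (Suc r)) F (mult_power C F \<eta> (Suc r))"
  have "zero_object \<A> ((image_object C F ^^ Suc r) (b, f))" if A: "(b, f) \<in> Obj \<A>" for b f
  proof -
    note b = eta_objectsD[OF A]
    have "mult_power C F \<eta> (Suc r) b = Zero C (OMap (functor_power F (Suc r)) b) (OMap F b)"
      using zero b(1) by (simp add: is_zero_transformation_def)
    then have "action_power b f (Suc r) = Zero C (OMap (functor_power F (Suc r)) b) b"
      using action_power_eq_mult_power[OF A, of r]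
        Comp_Zero[OF b(2) Hom_Obj(1)[OF mult_power_Hom[OF b(1), of r]]] by metis
    then show ?thesis
      using iterated_image_zero_iff[OF A] by blast
  qed
  then show "uniformly_image_nilpotent C F \<eta> (Suc r)"
    unfolding uniformly_image_nilpotent_def by auto
qed

text \<open>The first power is the identity, so the second is \<eta> after \<open>F\<close> of an
  identity; this makes a vanishing \<eta> the case of exponent two.\<close>

lemma mult_power_two: "a \<in> Obj C \<Longrightarrow> mult_power C F \<eta> 2 a = \<eta> a"
  using endo.AMap_Ident[OF endo.OMap_Obj] Comp_Ident[OF \<eta>_Hom]
  by (simp add: numeral_2_eq_2 vertical_comp_def whisker_left_def id_transformation_def)

end

theorem theorem3p6:
  fixes B :: "('o, 'm, 'z) addcat_scheme"
    and F :: "('o, 'm, 'o, 'm) func"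
    and \<eta> :: "'o \<Rightarrow> 'm"
  assumes "abelian_category B"
    and "enough_projectives B"
    and "enough_injectives B"
    and "additive_functor B B F"
    and "preserves_right_exact_sequences B B F"
    and "natural_transformation B B (functor_power F 2) F \<eta>"
    and "associative_multiplication B F \<eta>"
  shows "(\<forall>d \<ge> 1. uniformly_image_nilpotent B F \<eta> d \<longleftrightarrow>
            is_zero_transformation B B (functor_power F d) F (mult_power B F \<eta> d))
       \<and> (is_zero_transformation B B (functor_power F 2) F \<eta> \<longrightarrow>
            uniformly_image_nilpotent B F \<eta> 2)"
proof -
  interpret associative_extension B F \<eta>
    using assms by (intro associative_extension.intro associative_extension_axioms.intro)
  \<comment> \<open>Since \<open>d \<ge> 1\<close>, \<open>d\<close> is the successor of
    \<open>d - 1\<close>.\<close>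
  have iff: "uniformly_image_nilpotent B F \<eta> d \<longleftrightarrow>
      is_zero_transformation B B (functor_power F d) F (mult_power B F \<eta> d)" if "d \<ge> 1" for d
    using that uniformly_image_nilpotent_iff[of "d - 1"] by simp
  moreover have "uniformly_image_nilpotent B F \<eta> 2"
    if "is_zero_transformation B B (functor_power F 2) F \<eta>"
    using that iff[of 2] mult_power_two by (simp add: is_zero_transformation_def)
  ultimately show ?thesis by blast
qed

end
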